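(* Let $q,b,z_d\in\mathbb{R}$ with $q\neq0$, $M_1>0$ and $\alpha>0$. Let $g_{\alpha_{op}}$ be the minimizer of $J_{1\alpha}$ over $\mathbb{R}$ and, for $h=x_0/n$ with $n\ge1$ an integer, let $g^h_{\alpha_{op}}$ be the minimizer of $J^h_{1\alpha}$ over $\mathbb{R}$. (a) $$g^h_{\alpha_{op}}=\frac q{3x_0}\,\frac{A_{1\alpha}+\frac h{x_0}A_{2\alpha}+\frac{h^2}{x_0^2}A_{3\alpha}}{A_{4\alpha}+A_{5\alpha}(h)},$$ where $$A_{1\alpha}=\tfrac58-\tfrac{b-z_d}{qx_0}+\tfrac1{\alpha x_0}\left(\tfrac52+\tfrac3{\alpha x_0}-\tfrac{3(b-z_d)}{qx_0}\right),$$ $$A_{2\alpha}=\tfrac{3(b-z_d)}{4qx_0}-\tfrac12+\tfrac1{\alpha x_0}\left(-\tfrac94-\tfrac3{\alpha x_0}+\tfrac{3(b-z_d)}{qx_0}\right),$$ $$A_{3\alpha}=\tfrac{b-z_d}{4qx_0}-\tfrac18-\tfrac1{4\alpha x_0},\qquad A_{4\alpha}=\tfrac2{15}+\tfrac{M_1}{x_0^4}+\tfrac1{\alpha x_0}\left(\tfrac23+\tfrac1{\alpha x_0}\right),$$ $$A_{5\alpha}(h)=\tfrac h{12x_0}\left(\tfrac{h^3}{15x_0^3}+\tfrac{h^2}{2x_0^2}+\tfrac h{3x_0}-\tfrac52\right)+\tfrac h{\alpha x_0^2}\left(-\tfrac76+\tfrac h{3x_0}+\tfrac{h^2}{6x_0^2}+\tfrac1{\alpha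 x_0}\left(-2+\tfrac h{x_0}\right)\right).$$ (b) There are constants $C_{3\alpha},C_{4\alpha}$ not depending on $h$ such that, as $h\to0$ ($h=x_0/n$, $n\to\infty$), $$|g_{\alpha_{op}}-g^h_{\alpha_{op}}|=C_{3\alpha}h+o(h),\qquad |J_{1\alpha}(g_{\alpha_{op}})-J^h_{1\alpha}(g^h_{\alpha_{op}})|=C_{4\alpha}h+o(h).$$
   Context: Fix $x_0,y_0>0$, $\Omega=(0,x_0)\times(0,y_0)$ and $H=L^2(\Omega)$ with its standard norm. For constants $g,q,b\in\mathbb{R}$ and $\alpha>0$, the system $-\Delta u=g$ in $\Omega$, $-\partial u/\partial n=\alpha(u-b)$ on $\{0\}\times(0,y_0]$, $-\partial u/\partial n=q$ on $\{x_0\}\times(0,y_0]$, $-\partial u/\partial n=0$ on $[0,x_0]\times\{0,y_0\}$ has solution $u_{\alpha g}(x,y)=-\tfrac12gx^2+(gx_0-q)x+\tfrac1\alpha(gx_0-q)+b$. For an integer $n\ge1$, $h=x_0/n$, $x_i=(i-1)h$, its discrete (finite-difference, piecewise linear) approximation is $u^h_{\alpha g}(x,y)=(gx_0-q-hgi)x+b+\tfrac{gx_0-q}\alpha-\tfrac{gh}\alpha+\tfrac{i^2-i}2gh^2$ for $x\in[x_i,x_{i+1}]$, $y\in[0,y_0]$, $i=1,\dots,n$. For fixed $q,b,z_d\in\mathbb{R}$ and $M_1>0$ the cost functions on $\mathbb{R}$ are $J_{1\alpha}(g)=\tfrac12\|u_{\alpha g}-z_d\|_H^2+\tfrac{M_1}2\|g\|_H^2$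 and $J^h_{1\alpha}(g)=\tfrac12\|u^h_{\alpha g}-z_d\|_H^2+\tfrac{M_1}2\|g\|_H^2$, where constants are viewed as constant functions on $\Omega$ (so $\|g\|_H^2=x_0y_0g^2$). The minimizer of $J_{1\alpha}$ is $g_{\alpha_{op}}=\frac q{3x_0}\left(\tfrac58-\tfrac{b-z_d}{qx_0}+\tfrac5{2\alpha x_0}+\tfrac3{\alpha^2x_0^2}-\tfrac{3(b-z_d)}{\alpha qx_0^2}\right)\Big/\left(\tfrac2{15}+\tfrac{M_1}{x_0^4}+\tfrac2{3\alpha x_0}+\tfrac1{\alpha^2x_0^2}\right)$. *)

theory Defs
  imports "HOL-Analysis.Analysis" "HOL-Library.Landau_Symbols"
begin

definition Omega :: "real \<Rightarrow> real \<Rightarrow> (real \<times> real) set" where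
  "Omega x0 y0 = {0<..<x0} \<times> {0<..<y0}"

definition H_norm :: "real \<Rightarrow> real \<Rightarrow> (real \<times> real \<Rightarrow> real) \<Rightarrow> real" where
  "H_norm x0 y0 f = sqrt (LINT z:Omega x0 y0|lborel. (f z)\<^sup>2)"

definition u_cont :: "real \<Rightarrow> real \<Rightarrow> real \<Rightarrow> real \<Rightarrow> real \<Rightarrow> real \<times> real \<Rightarrow> real" where
  "u_cont x0 \<alpha> q b g = (\<lambda>(x, y). - (1/2) * g * x\<^sup>2 + (g * x0 - q) * x + (1/\<alpha>) * (g * x0 - q) + b)"

text \<open>This function solves the mixed boundary value problem: the Poisson equation, the Robin
  condition at \<open>x = 0\<close>, flux \<open>q\<close> at \<open>x = x0\<close>, and no flux in the direction \<open>y\<close>. The outer normal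
  derivative is \<open>- d/dx\<close> on the left side and \<open>d/dx\<close> on the right side.\<close>

lemma u_cont_solves:
  assumes "\<alpha> > 0"
  shows "- (deriv (deriv (\<lambda>s. u_cont x0 \<alpha> q b g (s, y))) x
            + deriv (deriv (\<lambda>t. u_cont x0 \<alpha> q b g (x, t))) y) = g"
    and "deriv (\<lambda>s. u_cont x0 \<alpha> q b g (s, y)) 0 = \<alpha> * (u_cont x0 \<alpha> q b g (0, y) - b)"
    and "- deriv (\<lambda>s. u_cont x0 \<alpha> q b g (s, y)) x0 = q"
    and "deriv (\<lambda>t. u_cont x0 \<alpha> q b g (x, t)) y = 0"
proof -
  have 1: "deriv (\<lambda>s. u_cont x0 \<alpha> q b g (s, y)) = (\<lambda>x. g * x0 - q - g * x)" for y
  proof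
    fix x
    have "((\<lambda>s. u_cont x0 \<alpha> q b g (s, y)) has_real_derivative g * x0 - q - g * x) (at x)"
      unfolding u_cont_def by (auto intro!: derivative_eq_intros)
    then show "deriv (\<lambda>s. u_cont x0 \<alpha> q b g (s, y)) x = g * x0 - q - g * x"
      by (rule DERIV_imp_deriv)
  qed
  have 2: "deriv (\<lambda>x. g * x0 - q - g * x) x = - g" for x
    by (rule DERIV_imp_deriv) (auto intro!: derivative_eq_intros)
  have 3: "deriv (\<lambda>t. u_cont x0 \<alpha> q b g (x, t)) = (\<lambda>_. 0)" for x
    by (simp add: u_cont_def fun_eq_iff)
  show "- (deriv (deriv (\<lambda>s. u_cont x0 \<alpha> q b g (s, y))) x
            + deriv (deriv (\<lambda>t. u_cont x0 \<alpha> q b g (x, t))) y) = g"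
    by (simp add: 1 2 3)
  show "deriv (\<lambda>s. u_cont x0 \<alpha> q b g (s, y)) 0 = \<alpha> * (u_cont x0 \<alpha> q b g (0, y) - b)"
    using assms by (simp only: 1) (simp add: u_cont_def)
  show "- deriv (\<lambda>s. u_cont x0 \<alpha> q b g (s, y)) x0 = q"
    by (simp add: 1)
  show "deriv (\<lambda>t. u_cont x0 \<alpha> q b g (x, t)) y = 0"
    by (simp add: 3)
qed

definition mesh :: "real \<Rightarrow> nat \<Rightarrow> real" where
  "mesh x0 n = x0 / real n"

definition u_piece :: "real \<Rightarrow> real \<Rightarrow> real \<Rightarrow> real \<Rightarrow> real \<Rightarrow> real \<Rightarrow> nat \<Rightarrow> real \<Rightarrow> real" where
  "u_piece x0 \<alpha> q b h g i x =
     (g * x0 - q - h * g * real i) * x + b + (g * x0 - q) / \<alpha> - g * h / \<alpha>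
       + ((real i)\<^sup>2 - real i) / 2 * g * h\<^sup>2"

text \<open>The index \<open>max 1 (nat \<lceil>x / h\<rceil>)\<close> selects the interval \<open>[(i-1)h, ih]\<close> containing \<open>x\<close>; the choice
  at the nodes is irrelevant, because neighbouring pieces agree there (lemma \<open>u_disc_piece\<close>).\<close>

definition u_disc :: "real \<Rightarrow> real \<Rightarrow> real \<Rightarrow> real \<Rightarrow> nat \<Rightarrow> real \<Rightarrow> real \<times> real \<Rightarrow> real" where
  "u_disc x0 \<alpha> q b n g =
     (\<lambda>(x, y). u_piece x0 \<alpha> q b (mesh x0 n) g (max 1 (nat \<lceil>x / mesh x0 n\<rceil>)) x)"

lemma u_disc_piece:
  assumes "x0 > 0" "i \<in> {1..n}"
    and "x \<in> {(real i - 1) * mesh x0 n .. real i * mesh x0 n}"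
  shows "u_disc x0 \<alpha> q b n g (x, y) = u_piece x0 \<alpha> q b (mesh x0 n) g i x"
proof -
  define h where "h = mesh x0 n"
  have h: "h > 0" using assms by (simp add: h_def mesh_def)
  have x: "(real i - 1) * h \<le> x" "x \<le> real i * h" and i: "1 \<le> i"
    using assms by (auto simp: h_def)
  show ?thesis
  proof (cases "x = (real i - 1) * h")
    case x_node: True
    then have "x / h = real (i - 1)" using h i by (simp add: of_nat_diff)
    then have c: "nat \<lceil>x / h\<rceil> = i - 1" by simp
    show ?thesis
    proof (cases "i = 1")
      case True
      then show ?thesis using c by (simp add: u_disc_def h_def)
    next
      case False
      then have "max 1 (i - 1) = i - 1" "real (i - 1) = real i - 1" using i by auto
      then have "u_disc x0 \<alpha> q b n g (x, y) = u_piece x0 \<alpha> q b h g (i - 1) x"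
        using c by (simp add: u_disc_def h_def)
      also have "\<dots> = u_piece x0 \<alpha> q b h g i x"
        unfolding u_piece_def x_node \<open>real (i - 1) = real i - 1\<close>
        by (simp add: algebra_simps power2_eq_square diff_divide_distrib add_divide_distrib)
      finally show ?thesis by (simp add: h_def)
    qed
  next
    case False
    then have "real i - 1 < x / h" "x / h \<le> real i"
      using x h by (auto simp: field_simps)
    then have "\<lceil>x / h\<rceil> = int i" by (simp add: ceiling_eq_iff)
    then show ?thesis using i by (simp add: u_disc_def h_def max_def)
  qed
qed

definition J1 :: "real \<Rightarrow> real \<Rightarrow> real \<Rightarrow> real \<Rightarrow> real \<Rightarrow> real \<Rightarrow> real \<Rightarrow> real \<Rightarrow> real" where
  "J1 x0 y0 \<alpha> q b zd M1 g =
     1/2 * (H_norm x0 y0 (\<lambda>z. u_cont x0 \<alpha> q b g z - zd))\<^sup>2 + M1/2 * (H_norm x0 y0 (\<lambda>_. g))\<^sup>2"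

definition J1_disc :: "real \<Rightarrow> real \<Rightarrow> real \<Rightarrow> real \<Rightarrow> real \<Rightarrow> real \<Rightarrow> real \<Rightarrow> nat \<Rightarrow> real \<Rightarrow> real" where
  "J1_disc x0 y0 \<alpha> q b zd M1 n g =
     1/2 * (H_norm x0 y0 (\<lambda>z. u_disc x0 \<alpha> q b n g z - zd))\<^sup>2 + M1/2 * (H_norm x0 y0 (\<lambda>_. g))\<^sup>2"

definition g_op :: "real \<Rightarrow> real \<Rightarrow> real \<Rightarrow> real \<Rightarrow> real \<Rightarrow> real \<Rightarrow> real \<Rightarrow> real" where
  "g_op x0 y0 \<alpha> q b zd M1 = arg_min (J1 x0 y0 \<alpha> q b zd M1) (\<lambda>_. True)"

definition g_op_disc :: "real \<Rightarrow> real \<Rightarrow> real \<Rightarrow> real \<Rightarrow> real \<Rightarrow> real \<Rightarrow> real \<Rightarrow> nat \<Rightarrow> real" where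
  "g_op_disc x0 y0 \<alpha> q b zd M1 n = arg_min (J1_disc x0 y0 \<alpha> q b zd M1 n) (\<lambda>_. True)"

definition A1 :: "real \<Rightarrow> real \<Rightarrow> real \<Rightarrow> real \<Rightarrow> real \<Rightarrow> real" where
  "A1 x0 \<alpha> q b zd = 5/8 - (b - zd) / (q * x0)
     + 1 / (\<alpha> * x0) * (5/2 + 3 / (\<alpha> * x0) - 3 * (b - zd) / (q * x0))"

definition A2 :: "real \<Rightarrow> real \<Rightarrow> real \<Rightarrow> real \<Rightarrow> real \<Rightarrow> real" where
  "A2 x0 \<alpha> q b zd = 3 * (b - zd) / (4 * q * x0) - 1/2
     + 1 / (\<alpha> * x0) * (- (9/4) - 3 / (\<alpha> * x0) + 3 * (b - zd) / (q * x0))"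

definition A3 :: "real \<Rightarrow> real \<Rightarrow> real \<Rightarrow> real \<Rightarrow> real \<Rightarrow> real" where
  "A3 x0 \<alpha> q b zd = (b - zd) / (4 * q * x0) - 1/8 - 1 / (4 * \<alpha> * x0)"

definition A4 :: "real \<Rightarrow> real \<Rightarrow> real \<Rightarrow> real" where
  "A4 x0 \<alpha> M1 = 2/15 + M1 / x0 ^ 4 + 1 / (\<alpha> * x0) * (2/3 + 1 / (\<alpha> * x0))"

definition A5 :: "real \<Rightarrow> real \<Rightarrow> real \<Rightarrow> real" where
  "A5 x0 \<alpha> h =
     h / (12 * x0) * (h ^ 3 / (15 * x0 ^ 3) + h\<^sup>2 / (2 * x0\<^sup>2) + h / (3 * x0) - 5/2)
     + h / (\<alpha> * x0\<^sup>2) * (- (7/6) + h / (3 * x0) + h\<^sup>2 / (6 * x0\<^sup>2)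
         + 1 / (\<alpha> * x0) * (- 2 + h / x0))"

end

theory Submission
  imports Defs
begin

text \<open>
  The state is affine in the control: the continuous state is \<open>g \<phi>\<^sub>0 + \<psi>\<close> and the discrete state
  is \<open>g \<phi>\<^sub>h + \<psi>\<close>, where \<open>\<phi>\<close> is the response to a unit source with homogeneous data and \<open>\<psi>\<close> is the
  state for \<open>g = 0\<close>. The state \<open>\<psi>\<close> is a linear function of \<open>x\<close>, which the finite-difference scheme
  reproduces exactly, so it is the same in both cases. With the target absorbed into \<open>\<psi>\<close>, each cost
  is therefore
  \<open>y0/2 ((\<integral>\<phi>\<^sup>2 + M1 x0) g\<^sup>2 + 2 (\<integral>\<phi> \<psi>) g + \<integral>\<psi>\<^sup>2)\<close>,
  and only the first two coefficients depend on the mesh. A quadratic with positive leading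
  coefficient \<open>D\<close> and linear coefficient \<open>- 2 N\<close> has exactly one minimizer, \<open>N/D\<close>.

  Summing the integrals of the affine pieces over the mesh (lemma
  \<open>integral_unit_response_disc\<close>) shows that \<open>D = opt_den h\<close> and \<open>N = opt_num h\<close> are polynomials
  in \<open>h\<close>, which up to constant factors are the denominator and numerator of the claimed formula.
  The continuous problem gives the values of the same polynomials at \<open>h = 0\<close> (lemma
  \<open>integral_unit_response_cont\<close>). So the optimal control \<open>N/D\<close> and the optimal value
  \<open>y0/2 (\<integral>\<psi>\<^sup>2 - N\<^sup>2/D)\<close> are, for both problems, the values at \<open>h = x0/n\<close> and at \<open>h = 0\<close> of
  one rational function. It is differentiable at \<open>0\<close> because \<open>D 0 > 0\<close>, and a first-order
  expansion at \<open>0\<close> gives both error estimates, with the absolute value of the derivative as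
  constant (lemma \<open>mesh_expansion_abs_diff\<close>).
\<close>

section \<open>Integrals over the strip and over a uniform grid\<close>

text \<open>Fubini for functions of the first coordinate. Continuity up to the boundary makes the
  integrand Lebesgue integrable, so that its Lebesgue integral can be computed as a
  Henstock--Kurzweil integral.\<close>

lemma H_norm_power2_strip:
  assumes "x0 > 0" "y0 > 0" and f: "continuous_on {0..x0} f"
    and I: "((\<lambda>x. (f x)\<^sup>2) has_integral I) {0..x0}"
  shows "(H_norm x0 y0 (\<lambda>z. f (fst z)))\<^sup>2 = y0 * I"
proof -
  define F where "F z = indicator (Omega x0 y0) z *\<^sub>R (f (fst z))\<^sup>2" for z
  have "set_integrable lborel ({0..x0} \<times> {0..y0}) (\<lambda>z. (f (fst z))\<^sup>2)"
    unfolding set_integrable_def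
    by (intro borel_integrable_compact compact_Times continuous_intros
        continuous_on_compose2[OF f]) auto
  moreover have meas: "Omega x0 y0 \<in> sets lborel"
    unfolding Omega_def by (simp add: open_Times)
  ultimately have "set_integrable lborel (Omega x0 y0) (\<lambda>z. (f (fst z))\<^sup>2)"
    by (rule set_integrable_subset) (auto simp: Omega_def)
  then have F: "integrable (lborel \<Otimes>\<^sub>M lborel) F"
    by (simp add: set_integrable_def F_def[abs_def] lborel_prod)
  have "set_integrable lborel {0..x0} (\<lambda>x. (f x)\<^sup>2)"
    unfolding set_integrable_def
    by (intro borel_integrable_compact continuous_intros f) auto
  then have f2: "set_integrable lborel {0<..<x0} (\<lambda>x. (f x)\<^sup>2)"
    by (rule set_integrable_subset) auto
  have "((\<lambda>x. (f x)\<^sup>2) has_integral I) {0<..<x0}"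
    using I has_integral_open_interval[of "\<lambda>x. (f x)\<^sup>2" I 0 x0] by simp
  then have I1: "(LINT x:{0<..<x0}|lborel. (f x)\<^sup>2) = I"
    using set_borel_integral_eq_integral(2)[OF f2] by (simp add: integral_unique)
  have "(LINT z:Omega x0 y0|lborel. (f (fst z))\<^sup>2) = integral\<^sup>L (lborel \<Otimes>\<^sub>M lborel) F"
    by (simp add: set_lebesgue_integral_def F_def[abs_def] lborel_prod)
  also have "\<dots> = (LINT x|lborel. LINT y|lborel. F (x, y))"
    using lborel_pair.integral_fst'[OF F] by simp
  also have "\<dots> = (LINT x|lborel. y0 * (indicator {0<..<x0} x *\<^sub>R (f x)\<^sup>2))"
  proof (intro Bochner_Integration.integral_cong refl)
    fix x
    have "F (x, y) = indicator {0<..<y0} y *\<^sub>R (indicator {0<..<x0} x * (f x)\<^sup>2)" for y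
      by (auto simp: F_def Omega_def indicator_def)
    then show "(LINT y|lborel. F (x, y)) = y0 * (indicator {0<..<x0} x *\<^sub>R (f x)\<^sup>2)"
      using \<open>y0 > 0\<close> by simp
  qed
  also have "\<dots> = y0 * I"
    using I1 by (simp add: set_lebesgue_integral_def)
  finally have eq: "(LINT z:Omega x0 y0|lborel. (f (fst z))\<^sup>2) = y0 * I" .
  have "I \<ge> 0"
    using I by (rule has_integral_nonneg) simp
  then show ?thesis
    using \<open>y0 > 0\<close> by (simp add: H_norm_def eq)
qed

text \<open>The discrete state is given by one formula per cell, endpoints included. The formulas agree at
  the nodes, so they can be glued cell by cell, for continuity as well as for integrals.\<close>

lemma
  fixes f :: "real \<Rightarrow> real" and P :: "nat \<Rightarrow> real \<Rightarrow> real"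
  assumes "h \<ge> 0"
    and eq: "\<And>i x. i \<in> {1..n} \<Longrightarrow> x \<in> {(real i - 1) * h..real i * h} \<Longrightarrow> f x = P i x"
  shows continuous_on_grid:
      "(\<And>i. i \<in> {1..n} \<Longrightarrow> continuous_on {(real i - 1) * h..real i * h} (P i)) \<Longrightarrow>
        continuous_on {0..real n * h} f"
    and has_integral_grid:
      "(\<And>i. i \<in> {1..n} \<Longrightarrow> (P i has_integral I i) {(real i - 1) * h..real i * h}) \<Longrightarrow>
        (f has_integral (\<Sum>i=1..n. I i)) {0..real n * h}"
proof -
  have eq': "f x = P (Suc k) x" if "Suc k \<le> n" "x \<in> {real k * h..real (Suc k) * h}" for k x
    using eq[of "Suc k" x] that by simp
  have le: "0 \<le> real k * h" "real k * h \<le> real (Suc k) * h" for k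
    using \<open>h \<ge> 0\<close> by (auto intro: mult_right_mono)
  have Un: "{0..real (Suc k) * h} = {0..real k * h} \<union> {real k * h..real (Suc k) * h}" for k
    using le[of k] by auto
  show "continuous_on {0..real n * h} f"
    if cont: "\<And>i. i \<in> {1..n} \<Longrightarrow> continuous_on {(real i - 1) * h..real i * h} (P i)"
  proof -
    have "continuous_on {0..real k * h} f" if "k \<le> n" for k
      using that
    proof (induction k)
      case (Suc k)
      have "continuous_on {real k * h..real (Suc k) * h} f"
        using cont[of "Suc k"] Suc.prems by (subst continuous_on_cong[OF refl eq']) simp_all
      with Suc show ?case
        unfolding Un by (intro continuous_on_closed_Un) auto
    qed simp
    then show ?thesis by simp
  qed
  show "(f has_integral (\<Sum>i=1..n. I i)) {0..real n * h}"
    if int: "\<And>i. i \<in> {1..n} \<Longrightarrow> (P i has_integral I i) {(real i - 1) * h..real i * h}"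
  proof -
    have "(f has_integral (\<Sum>i=1..k. I i)) {0..real k * h}" if "k \<le> n" for k
      using that
    proof (induction k)
      case (Suc k)
      have "(P (Suc k) has_integral I (Suc k)) {real k * h..real (Suc k) * h}"
        using int[of "Suc k"] Suc.prems by simp
      then have "(f has_integral I (Suc k)) {real k * h..real (Suc k) * h}"
        by (rule has_integral_eq[rotated]) (use eq' Suc.prems in auto)
      with Suc show ?case
        using has_integral_combine[OF le] by simp
    qed (simp add: has_integral_refl)
    then show ?thesis by simp
  qed
qed

lemma has_integral_affine_mult_affine:
  fixes a b :: real
  assumes "a \<le> b"
  shows "((\<lambda>x. (m * x + w) * (m' * x + w')) has_integral
    m * m' * (b^3 - a^3) / 3 + (m * w' + m' * w) * (b\<^sup>2 - a\<^sup>2) / 2 + w * w' * (b - a)) {a..b}"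
proof -
  define Q where "Q x = m * m' * x^3 / 3 + (m * w' + m' * w) * x\<^sup>2 / 2 + w * w' * x" for x
  have "((\<lambda>x. (m * x + w) * (m' * x + w')) has_integral Q b - Q a) {a..b}"
    unfolding Q_def using assms
    by (intro fundamental_theorem_of_calculus)
      (auto intro!: derivative_eq_intros
        simp: has_real_derivative_iff_has_vector_derivative[symmetric] algebra_simps power2_eq_square)
  then show ?thesis
    by (simp add: Q_def algebra_simps diff_divide_distrib add_divide_distrib)
qed

lemma sum_quartic:
  fixes c0 c1 c2 c3 c4 :: real
  shows "(\<Sum>i=1..n. c0 + c1 * real i + c2 * real i ^ 2 + c3 * real i ^ 3 + c4 * real i ^ 4) =
    c0 * n + c1 * (real n * (real n + 1) / 2) + c2 * (real n * (real n + 1) * (2 * real n + 1) / 6)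
    + c3 * (real n ^ 2 * (real n + 1) ^ 2 / 4)
    + c4 * (real n * (real n + 1) * (2 * real n + 1) * (3 * real n ^ 2 + 3 * real n - 1) / 30)"
  by (induction n) (simp_all add: field_simps power_numeral_reduce)

section \<open>The coefficients of the quadratic cost\<close>

text \<open>The factors \<open>q * x0 ^ 4 / 3\<close> and \<open>x0 ^ 5\<close> below undo the normalisation of the coefficients \<open>A1\<close> to
  \<open>A5\<close>: with them, numerator and denominator become exactly the integrals \<open>- \<integral>\<phi> \<psi>\<close> and
  \<open>\<integral>\<phi>\<^sup>2 + M1 x0\<close>.\<close>

definition opt_num :: "real \<Rightarrow> real \<Rightarrow> real \<Rightarrow> real \<Rightarrow> real \<Rightarrow> real \<Rightarrow> real" where
  "opt_num x0 \<alpha> q b zd h = q * x0 ^ 4 / 3 *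
     (A1 x0 \<alpha> q b zd + h / x0 * A2 x0 \<alpha> q b zd + h\<^sup>2 / x0\<^sup>2 * A3 x0 \<alpha> q b zd)"

definition opt_den :: "real \<Rightarrow> real \<Rightarrow> real \<Rightarrow> real \<Rightarrow> real" where
  "opt_den x0 \<alpha> M1 h = x0 ^ 5 * (A4 x0 \<alpha> M1 + A5 x0 \<alpha> h)"

lemma opt_den_split:
  assumes "x0 > 0"
  shows "opt_den x0 \<alpha> M1 h = opt_den x0 \<alpha> 0 h + M1 * x0"
  using assms by (simp add: opt_den_def A4_def field_simps power_numeral_reduce)

text \<open>The next two lemmas clear the denominators \<open>q\<close> and \<open>x0\<close>. The constants \<open>1 / \<alpha>\<close> and \<open>r\<close>,
  the value of \<open>\<psi>\<close> at \<open>x = 0\<close>, are treated as independent variables; the identities between integrals and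
  coefficients are then purely polynomial.\<close>

lemma opt_num_polynomial:
  fixes x0 \<alpha> q b zd h :: real
  assumes "x0 > 0" "\<alpha> > 0" "q \<noteq> 0"
  defines "\<beta> \<equiv> 1 / \<alpha>"
  defines "r \<equiv> b - q * \<beta> - zd"
  shows "opt_num x0 \<alpha> q b zd h = q * (5/24 * x0^4 - x0^3*h/6 - x0\<^sup>2*h\<^sup>2/24)
    - r * (x0^3/3 - x0\<^sup>2*h/4 - x0*h\<^sup>2/12) + \<beta> * (x0\<^sup>2 - x0*h) * (q*x0/2 - r)"
  using assms(1-3)
  by (simp add: opt_num_def A1_def A2_def A3_def \<beta>_def r_def divide_simps) algebra

lemma opt_den_polynomial:
  assumes "x0 > 0" "\<alpha> > 0"
  shows "opt_den x0 \<alpha> 0 h = 2/15*x0^5 - 5/24*x0^4*h + x0^3*h\<^sup>2/36 + x0\<^sup>2*h^3/24 + x0*h^4/180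
    + 1/\<alpha> * (2/3*x0^4 - 7/6*x0^3*h + x0\<^sup>2*h\<^sup>2/3 + x0*h^3/6) + (1/\<alpha>)\<^sup>2 * x0 * (x0 - h)\<^sup>2"
  using assms by (simp add: opt_den_def A4_def A5_def divide_simps) algebra

text \<open>On the \<open>i\<close>-th cell the unit response is the affine function \<open>m i * x + w i\<close>. The integral of its
  square over the cell is a polynomial of degree 4 in \<open>i\<close>, that of its product with \<open>\<psi>\<close> one of
  degree 3. Expanding them in powers of \<open>i\<close> reduces the sum over the cells to power sums; the
  relation \<open>x0 = n h\<close> then eliminates \<open>n\<close> and leaves a polynomial in \<open>h\<close>.\<close>

lemma integral_unit_response_disc:
  assumes "x0 > 0" "\<alpha> > 0" "n \<ge> 1"
  defines "\<phi> \<equiv> \<lambda>x. u_disc x0 \<alpha> 0 0 n 1 (x, 0)"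
  shows "continuous_on {0..x0} \<phi>"
    and "((\<lambda>x. (\<phi> x)\<^sup>2) has_integral opt_den x0 \<alpha> 0 (mesh x0 n)) {0..x0}"
    and "q \<noteq> 0 \<Longrightarrow> ((\<lambda>x. \<phi> x * (u_cont x0 \<alpha> q b 0 (x, 0) - zd)) has_integral
      - opt_num x0 \<alpha> q b zd (mesh x0 n)) {0..x0}"
proof -
  define h N where "h = mesh x0 n" and "N = real n"
  define \<beta> where "\<beta> = 1 / \<alpha>"
  define c r where "c = (x0 - h) * \<beta>" and "r = b - q * \<beta> - zd"
  define m w where "m i = x0 - h * real i" and "w i = c + ((real i)\<^sup>2 - real i) / 2 * h\<^sup>2"
    for i :: nat
  have h: "h > 0" "x0 = N * h" "N > 0"
    using assms by (auto simp: h_def mesh_def N_def)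
  have grid: "real n * h = x0"
    using h(2) by (simp add: N_def)
  have le: "(real i - 1) * h \<le> real i * h" for i :: nat
    using h by simp
  have piece: "\<phi> x = m i * x + w i" if "i \<in> {1..n}" "x \<in> {(real i - 1) * h..real i * h}" for i x
    using u_disc_piece[of x0 i n x \<alpha> 0 0 1 0] that \<open>x0 > 0\<close>
    by (simp add: \<phi>_def h_def m_def w_def c_def u_piece_def \<beta>_def diff_divide_distrib)
  have psi: "u_cont x0 \<alpha> q b 0 (x, 0) - zd = - q * x + r" for x
    by (simp add: u_cont_def r_def \<beta>_def)
  show "continuous_on {0..x0} \<phi>"
    unfolding h(2) N_def
    by (rule continuous_on_grid[OF _ piece]) (use h in \<open>auto intro!: continuous_intros\<close>)
  let ?B = "\<lambda>i. real i * h" and ?A = "\<lambda>i. (real i - 1) * h"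
  have "((\<lambda>x. (\<phi> x)\<^sup>2) has_integral (\<Sum>i=1..n. m i * m i * (?B i ^3 - ?A i ^ 3) / 3
      + (m i * w i + m i * w i) * ((?B i)\<^sup>2 - (?A i)\<^sup>2) / 2 + w i * w i * (?B i - ?A i))) {0..real n * h}"
    by (rule has_integral_grid[OF _ _ has_integral_affine_mult_affine[OF le]])
      (use h piece in \<open>auto simp: power2_eq_square\<close>)
  moreover have "(\<Sum>i=1..n. m i * m i * (?B i ^3 - ?A i ^ 3) / 3
      + (m i * w i + m i * w i) * ((?B i)\<^sup>2 - (?A i)\<^sup>2) / 2 + w i * w i * (?B i - ?A i))
    = (\<Sum>i=1..n. (h^5*N\<^sup>2/3 - c*h^3*N + c\<^sup>2*h) + (- (h^5)*(N\<^sup>2 + N/6) + 2*c*h^3*N) * real i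
      + (h^5*(N\<^sup>2 + N/2 + 1/12) - c*h^3) * real i ^ 2 + (- (h^5)*N) * real i ^ 3
      + h^5/4 * real i ^ 4)"
    unfolding m_def w_def h(2)
    by (intro sum.cong refl) (simp add: field_simps power_numeral_reduce)
  moreover have "\<dots> = opt_den x0 \<alpha> 0 h"
    unfolding opt_den_polynomial[OF assms(1,2), folded \<beta>_def]
    unfolding sum_quartic c_def h(2)
    unfolding N_def
    by (simp add: field_simps power_numeral_reduce)
  ultimately show "((\<lambda>x. (\<phi> x)\<^sup>2) has_integral opt_den x0 \<alpha> 0 (mesh x0 n)) {0..x0}"
    by (simp only: grid flip: h_def)
  assume q: "q \<noteq> 0"
  have "((\<lambda>x. \<phi> x * (u_cont x0 \<alpha> q b 0 (x, 0) - zd)) has_integral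
    (\<Sum>i=1..n. m i * (- q) * (?B i ^3 - ?A i ^ 3) / 3
      + (m i * r + (- q) * w i) * ((?B i)\<^sup>2 - (?A i)\<^sup>2) / 2 + w i * r * (?B i - ?A i))) {0..real n * h}"
    unfolding psi
    by (rule has_integral_grid[OF _ _ has_integral_affine_mult_affine[OF le]])
      (use h piece in auto)
  moreover have "(\<Sum>i=1..n. m i * (- q) * (?B i ^3 - ?A i ^ 3) / 3
      + (m i * r + (- q) * w i) * ((?B i)\<^sup>2 - (?A i)\<^sup>2) / 2 + w i * r * (?B i - ?A i))
    = (\<Sum>i=1..n. (- q*h^4*N/3 - r*h^3*N/2 + c*q*h\<^sup>2/2 + c*r*h)
      + (q*h^4*(N + 1/12) + r*h^3*N - c*q*h\<^sup>2) * real i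
      + (- q*h^4*(N + 1/4) - r*h^3/2) * real i ^ 2 + (q*h^4/2) * real i ^ 3 + 0 * real i ^ 4)"
    unfolding m_def w_def h(2)
    by (intro sum.cong refl) (simp add: field_simps power_numeral_reduce)
  moreover have "\<dots> = - opt_num x0 \<alpha> q b zd h"
    unfolding opt_num_polynomial[where b = b and zd = zd, OF assms(1,2) q, folded \<beta>_def, folded r_def]
    unfolding sum_quartic c_def h(2)
    unfolding N_def
    by (simp add: field_simps power_numeral_reduce)
  ultimately show "((\<lambda>x. \<phi> x * (u_cont x0 \<alpha> q b 0 (x, 0) - zd)) has_integral
      - opt_num x0 \<alpha> q b zd (mesh x0 n)) {0..x0}"
    by (simp only: grid flip: h_def)
qed

text \<open>The limit case: the exact unit response yields the values at \<open>h = 0\<close> of the polynomials found for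
  the discrete one.\<close>

lemma integral_unit_response_cont:
  assumes "x0 > 0" "\<alpha> > 0"
  defines "\<phi> \<equiv> \<lambda>x. u_cont x0 \<alpha> 0 0 1 (x, 0)"
  shows "((\<lambda>x. (\<phi> x)\<^sup>2) has_integral opt_den x0 \<alpha> 0 0) {0..x0}"
    and "q \<noteq> 0 \<Longrightarrow> ((\<lambda>x. \<phi> x * (u_cont x0 \<alpha> q b 0 (x, 0) - zd)) has_integral
      - opt_num x0 \<alpha> q b zd 0) {0..x0}"
proof -
  define \<beta> where "\<beta> = 1 / \<alpha>"
  define c r where "c = x0 * \<beta>" and "r = b - q * \<beta> - zd"
  have phi: "\<phi> x = - (x\<^sup>2) / 2 + x0 * x + c" for x
    by (simp add: \<phi>_def u_cont_def c_def \<beta>_def)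
  have psi: "u_cont x0 \<alpha> q b 0 (x, 0) - zd = - q * x + r" for x
    by (simp add: u_cont_def r_def \<beta>_def)
  \<comment> \<open>\<open>P\<close> and \<open>Q\<close> are primitives of \<open>\<phi>\<^sup>2\<close> and \<open>\<phi> \<psi>\<close>.\<close>
  define P where "P x = x^5/20 - x0*x^4/4 + (x0\<^sup>2 - c)*x^3/3 + x0*c*x\<^sup>2 + c\<^sup>2*x" for x
  define Q where "Q x = q*x^4/8 - (q*x0 + r/2)*x^3/3 + (x0*r - c*q)*x\<^sup>2/2 + c*r*x" for x
  have "((\<lambda>x. (\<phi> x)\<^sup>2) has_integral P x0 - P 0) {0..x0}"
    unfolding P_def phi using assms
    by (intro fundamental_theorem_of_calculus)
      (auto intro!: derivative_eq_intros
        simp: has_real_derivative_iff_has_vector_derivative[symmetric] field_simps power_numeral_reduce)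
  moreover have "P x0 - P 0 = opt_den x0 \<alpha> 0 0"
    unfolding opt_den_polynomial[OF assms(1,2), folded \<beta>_def]
    unfolding P_def c_def
    by (simp add: field_simps power_numeral_reduce)
  ultimately show "((\<lambda>x. (\<phi> x)\<^sup>2) has_integral opt_den x0 \<alpha> 0 0) {0..x0}"
    by simp
  assume q: "q \<noteq> 0"
  have "((\<lambda>x. \<phi> x * (- q * x + r)) has_integral Q x0 - Q 0) {0..x0}"
    unfolding Q_def phi using assms
    by (intro fundamental_theorem_of_calculus)
      (auto intro!: derivative_eq_intros
        simp: has_real_derivative_iff_has_vector_derivative[symmetric] field_simps power_numeral_reduce)
  moreover have "Q x0 - Q 0 = - opt_num x0 \<alpha> q b zd 0"
    unfolding opt_num_polynomial[where b = b and zd = zd, OF assms(1,2) q, folded \<beta>_def, folded r_def]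
    unfolding Q_def c_def
    by (simp add: field_simps power_numeral_reduce)
  ultimately show "((\<lambda>x. \<phi> x * (u_cont x0 \<alpha> q b 0 (x, 0) - zd)) has_integral
      - opt_num x0 \<alpha> q b zd 0) {0..x0}"
    by (simp add: psi)
qed

section \<open>Both costs as quadratics in the control\<close>

lemma cost_is_quadratic:
  assumes "x0 > 0" "y0 > 0"
    and cont: "continuous_on {0..x0} \<phi>" "continuous_on {0..x0} \<psi>"
    and int: "((\<lambda>x. (\<phi> x)\<^sup>2) has_integral D) {0..x0}"
      "((\<lambda>x. \<phi> x * \<psi> x) has_integral - N) {0..x0}"
      "((\<lambda>x. (\<psi> x)\<^sup>2) has_integral E) {0..x0}"
  shows "1/2 * (H_norm x0 y0 (\<lambda>z. g * \<phi> (fst z) + \<psi> (fst z)))\<^sup>2 + M1/2 * (H_norm x0 y0 (\<lambda>_. g))\<^sup>2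
    = y0/2 * ((D + M1 * x0) * g\<^sup>2 - 2 * N * g + E)"
proof -
  have "((\<lambda>x. g\<^sup>2 * (\<phi> x)\<^sup>2 + 2 * g * (\<phi> x * \<psi> x) + (\<psi> x)\<^sup>2) has_integral
      g\<^sup>2 * D + 2 * g * (- N) + E) {0..x0}"
    by (intro has_integral_add has_integral_mult_right int)
  moreover have "(g * \<phi> x + \<psi> x)\<^sup>2 = g\<^sup>2 * (\<phi> x)\<^sup>2 + 2 * g * (\<phi> x * \<psi> x) + (\<psi> x)\<^sup>2" for x
    by (simp add: power2_eq_square algebra_simps)
  ultimately have "(H_norm x0 y0 (\<lambda>z. g * \<phi> (fst z) + \<psi> (fst z)))\<^sup>2
      = y0 * (g\<^sup>2 * D + 2 * g * (- N) + E)"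
    by (intro H_norm_power2_strip[of x0 y0 "\<lambda>x. g * \<phi> x + \<psi> x"] assms continuous_intros) simp
  moreover have "(H_norm x0 y0 (\<lambda>_. g))\<^sup>2 = y0 * (g\<^sup>2 * x0)"
    using H_norm_power2_strip[of x0 y0 "\<lambda>_. g"] has_integral_const_real[of "g\<^sup>2" 0 x0] assms
    by (simp add: mult.commute)
  ultimately show ?thesis
    by (simp add: algebra_simps)
qed

lemma J1_disc_quadratic:
  assumes "x0 > 0" "y0 > 0" "\<alpha> > 0" "q \<noteq> 0" "n \<ge> 1"
  shows "J1_disc x0 y0 \<alpha> q b zd M1 n g = y0/2 *
    (opt_den x0 \<alpha> M1 (mesh x0 n) * g\<^sup>2 - 2 * opt_num x0 \<alpha> q b zd (mesh x0 n) * g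
      + integral {0..x0} (\<lambda>x. (u_cont x0 \<alpha> q b 0 (x, 0) - zd)\<^sup>2))"
proof -
  have *: "u_disc x0 \<alpha> q b n g z - zd
    = g * u_disc x0 \<alpha> 0 0 n 1 (fst z, 0) + (u_cont x0 \<alpha> q b 0 (fst z, 0) - zd)" for z
    by (cases z) (simp add: u_disc_def u_piece_def u_cont_def algebra_simps
        diff_divide_distrib add_divide_distrib)
  have psi: "continuous_on {0..x0} (\<lambda>x. u_cont x0 \<alpha> q b 0 (x, 0) - zd)"
    unfolding u_cont_def by (auto intro!: continuous_intros)
  have psi2: "(\<lambda>x. (u_cont x0 \<alpha> q b 0 (x, 0) - zd)\<^sup>2) integrable_on {0..x0}"
    using psi by (intro integrable_continuous_interval continuous_on_power)
  show ?thesis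
    unfolding J1_disc_def * opt_den_split[OF assms(1), of \<alpha> M1]
    by (rule cost_is_quadratic[OF assms(1,2) integral_unit_response_disc(1) psi
          integral_unit_response_disc(2,3) integrable_integral[OF psi2]])
      (use assms in simp_all)
qed

lemma J1_quadratic:
  assumes "x0 > 0" "y0 > 0" "\<alpha> > 0" "q \<noteq> 0"
  shows "J1 x0 y0 \<alpha> q b zd M1 g = y0/2 *
    (opt_den x0 \<alpha> M1 0 * g\<^sup>2 - 2 * opt_num x0 \<alpha> q b zd 0 * g
      + integral {0..x0} (\<lambda>x. (u_cont x0 \<alpha> q b 0 (x, 0) - zd)\<^sup>2))"
proof -
  have *: "(\<lambda>z. u_cont x0 \<alpha> q b g z - zd)
    = (\<lambda>z. g * u_cont x0 \<alpha> 0 0 1 (fst z, 0) + (u_cont x0 \<alpha> q b 0 (fst z, 0) - zd))"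
    by (simp add: fun_eq_iff u_cont_def algebra_simps diff_divide_distrib add_divide_distrib)
  have cont: "continuous_on {0..x0} (\<lambda>x. u_cont x0 \<alpha> 0 0 1 (x, 0))"
    and psi: "continuous_on {0..x0} (\<lambda>x. u_cont x0 \<alpha> q b 0 (x, 0) - zd)"
    unfolding u_cont_def by (auto intro!: continuous_intros)
  have psi2: "(\<lambda>x. (u_cont x0 \<alpha> q b 0 (x, 0) - zd)\<^sup>2) integrable_on {0..x0}"
    using psi by (intro integrable_continuous_interval continuous_on_power)
  show ?thesis
    unfolding J1_def opt_den_split[OF assms(1), of \<alpha> M1]
    by (subst *, rule cost_is_quadratic[OF assms(1,2) cont psi
          integral_unit_response_cont integrable_integral[OF psi2]])
      (use assms in simp_all)
qed

text \<open>Positivity would be awkward to read off the coefficients; it holds because the part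
  without \<open>M1\<close> is the integral of a square.\<close>

lemma opt_den_pos:
  assumes "x0 > 0" "\<alpha> > 0" "M1 > 0"
  shows "opt_den x0 \<alpha> M1 0 > 0" and "n \<ge> 1 \<Longrightarrow> opt_den x0 \<alpha> M1 (mesh x0 n) > 0"
proof -
  have "0 < M1 * x0"
    using assms by simp
  then have shift: "opt_den x0 \<alpha> M1 h > 0" if "opt_den x0 \<alpha> 0 h \<ge> 0" for h
    using that opt_den_split[OF assms(1), of \<alpha> M1 h] by linarith
  show "opt_den x0 \<alpha> M1 0 > 0"
    by (rule shift[OF has_integral_nonneg[OF integral_unit_response_cont(1)[OF assms(1,2)]]]) simp
  show "opt_den x0 \<alpha> M1 (mesh x0 n) > 0" if "n \<ge> 1"
    by (rule shift[OF has_integral_nonneg[OF integral_unit_response_disc(2)[OF assms(1,2) that]]])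
      simp
qed

section \<open>Minimizers and first-order expansions\<close>

text \<open>Completing the square: \<open>J g = J (N/D) + c D (g - N/D)\<^sup>2\<close>.\<close>

lemma
  fixes J :: "real \<Rightarrow> real"
  assumes J: "\<And>g. J g = c * (D * g\<^sup>2 - 2 * N * g + E)" and "c > 0" "D > 0"
  shows is_arg_min_quadratic: "is_arg_min J (\<lambda>_. True) g \<longleftrightarrow> g = N / D"
    and min_quadratic: "J (N / D) = c * (E - N\<^sup>2 / D)"
proof -
  define m where "m = N / D"
  have N: "N = D * m"
    using \<open>D > 0\<close> by (simp add: m_def)
  have min: "J m = c * (E - D * m\<^sup>2)"
    by (simp add: J N power2_eq_square)
  also have "D * m\<^sup>2 = N\<^sup>2 / D"
    using \<open>D > 0\<close> by (simp add: N power2_eq_square)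
  finally show "J (N / D) = c * (E - N\<^sup>2 / D)"
    by (simp only: m_def)
  have square: "J g = J m + c * D * (g - m)\<^sup>2" for g
    unfolding min by (simp add: J N power2_eq_square algebra_simps)
  have le: "J m \<le> J g" for g
    using square[of g] assms(2,3) by simp
  have less: "J m < J g" if "g \<noteq> m" for g
    using square[of g] assms(2,3) that by simp
  have "is_arg_min J (\<lambda>_. True) g \<longleftrightarrow> g = m"
    unfolding is_arg_min_linorder using le less by (metis not_le)
  then show "is_arg_min J (\<lambda>_. True) g \<longleftrightarrow> g = N / D"
    by (simp only: m_def)
qed

text \<open>With derivative \<open>L\<close> at \<open>0\<close>, the difference quotient tends to \<open>L\<close> along the mesh sizes, so its
  absolute value tends to \<open>\<bar>L\<bar>\<close>. Hence one constant serves whatever the sign of the error.\<close>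

lemma mesh_expansion_abs_diff:
  fixes f :: "real \<Rightarrow> real"
  assumes "x0 > 0" "f differentiable at 0"
  shows "\<exists>C. (\<lambda>n. \<bar>f 0 - f (mesh x0 n)\<bar> - C * mesh x0 n) \<in> o(\<lambda>n. mesh x0 n)"
proof -
  obtain L where L: "(f has_real_derivative L) (at 0)"
    using assms(2) by (auto simp: real_differentiable_def)
  have pos: "\<forall>\<^sub>F n in sequentially. mesh x0 n > 0"
    using eventually_gt_at_top[of 0] by eventually_elim (use assms in \<open>simp add: mesh_def\<close>)
  have "mesh x0 \<longlonglongrightarrow> 0"
    unfolding mesh_def[abs_def] by (rule lim_const_over_n)
  then have "filterlim (mesh x0) (at 0) sequentially"
    using pos by (auto simp: filterlim_at elim: eventually_mono)
  with L[unfolded DERIV_def] have "(\<lambda>n. (f (0 + mesh x0 n) - f 0) / mesh x0 n) \<longlonglongrightarrow> L"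
    by (rule filterlim_compose)
  then have "(\<lambda>n. \<bar>(f (0 + mesh x0 n) - f 0) / mesh x0 n\<bar> - \<bar>L\<bar>) \<longlonglongrightarrow> \<bar>L\<bar> - \<bar>L\<bar>"
    by (intro tendsto_intros)
  moreover have "\<forall>\<^sub>F n in sequentially. \<bar>(f (0 + mesh x0 n) - f 0) / mesh x0 n\<bar> - \<bar>L\<bar>
      = (\<bar>f 0 - f (mesh x0 n)\<bar> - \<bar>L\<bar> * mesh x0 n) / mesh x0 n"
    using pos by eventually_elim (simp add: field_simps abs_minus_commute)
  ultimately have "(\<lambda>n. (\<bar>f 0 - f (mesh x0 n)\<bar> - \<bar>L\<bar> * mesh x0 n) / mesh x0 n) \<longlonglongrightarrow> 0"
    by (simp add: tendsto_cong)
  then show ?thesis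
    using pos by (intro exI[of _ "\<bar>L\<bar>"] smalloI_tendsto) (auto elim: eventually_mono)
qed

theorem lemma7:
  fixes x0 y0 \<alpha> q b zd M1 :: real
  assumes "x0 > 0" "y0 > 0" "\<alpha> > 0" "q \<noteq> 0" "M1 > 0"
  shows "(\<exists>!g. is_arg_min (J1 x0 y0 \<alpha> q b zd M1) (\<lambda>_. True) g)
    \<and> (\<forall>n\<ge>1. \<exists>!g. is_arg_min (J1_disc x0 y0 \<alpha> q b zd M1 n) (\<lambda>_. True) g)
    \<and> (\<forall>n\<ge>1. let h = mesh x0 n in
          g_op_disc x0 y0 \<alpha> q b zd M1 n =
            q / (3 * x0) * ((A1 x0 \<alpha> q b zd + h / x0 * A2 x0 \<alpha> q b zd + h\<^sup>2 / x0\<^sup>2 * A3 x0 \<alpha> q b zd)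
              / (A4 x0 \<alpha> M1 + A5 x0 \<alpha> h)))
    \<and> (\<exists>C3 C4.
          (\<lambda>n. \<bar>g_op x0 y0 \<alpha> q b zd M1 - g_op_disc x0 y0 \<alpha> q b zd M1 n\<bar> - C3 * mesh x0 n)
            \<in> o(\<lambda>n. mesh x0 n)
        \<and> (\<lambda>n. \<bar>J1 x0 y0 \<alpha> q b zd M1 (g_op x0 y0 \<alpha> q b zd M1)
                 - J1_disc x0 y0 \<alpha> q b zd M1 n (g_op_disc x0 y0 \<alpha> q b zd M1 n)\<bar> - C4 * mesh x0 n)
            \<in> o(\<lambda>n. mesh x0 n))"
proof -
  define N where "N = opt_num x0 \<alpha> q b zd"
  define D where "D = opt_den x0 \<alpha> M1"
  define E where "E = integral {0..x0} (\<lambda>x. (u_cont x0 \<alpha> q b 0 (x, 0) - zd)\<^sup>2)"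
  define gopt where "gopt h = N h / D h" for h
  define Jmin where "Jmin h = y0/2 * (E - (N h)\<^sup>2 / D h)" for h
  have y: "y0/2 > 0" using \<open>y0 > 0\<close> by simp
  have D0: "D 0 > 0" and Dn: "n \<ge> 1 \<Longrightarrow> D (mesh x0 n) > 0" for n
    unfolding D_def using opt_den_pos assms by auto
  have J: "J1 x0 y0 \<alpha> q b zd M1 g = y0/2 * (D 0 * g\<^sup>2 - 2 * N 0 * g + E)" for g
    unfolding D_def N_def E_def by (rule J1_quadratic) (use assms in auto)
  have Jn: "J1_disc x0 y0 \<alpha> q b zd M1 n g
      = y0/2 * (D (mesh x0 n) * g\<^sup>2 - 2 * N (mesh x0 n) * g + E)" if "n \<ge> 1" for n g
    unfolding D_def N_def E_def by (rule J1_disc_quadratic) (use assms that in auto)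
  note arg = is_arg_min_quadratic[OF J y D0]
  note argn = is_arg_min_quadratic[OF Jn y Dn]
  have g0: "g_op x0 y0 \<alpha> q b zd M1 = gopt 0"
    by (simp add: g_op_def arg_min_def arg gopt_def)
  have gn: "g_op_disc x0 y0 \<alpha> q b zd M1 n = gopt (mesh x0 n)" if "n \<ge> 1" for n
    using that by (simp add: g_op_disc_def arg_min_def argn gopt_def)
  have J0: "J1 x0 y0 \<alpha> q b zd M1 (gopt 0) = Jmin 0"
    unfolding gopt_def Jmin_def by (rule min_quadratic[OF J y D0])
  have Jmn: "J1_disc x0 y0 \<alpha> q b zd M1 n (gopt (mesh x0 n)) = Jmin (mesh x0 n)" if "n \<ge> 1" for n
    unfolding gopt_def Jmin_def by (rule min_quadratic[OF Jn y Dn]) (use that in auto)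
  have formula: "gopt h = q / (3 * x0) *
      ((A1 x0 \<alpha> q b zd + h / x0 * A2 x0 \<alpha> q b zd + h\<^sup>2 / x0\<^sup>2 * A3 x0 \<alpha> q b zd)
        / (A4 x0 \<alpha> M1 + A5 x0 \<alpha> h))" for h
    unfolding gopt_def N_def D_def opt_num_def opt_den_def
    using \<open>x0 > 0\<close> by (simp add: power_numeral_reduce)
  have dN: "N differentiable at 0"
    unfolding N_def opt_num_def[abs_def]
    by (intro derivative_intros) (use assms in auto)
  have dD: "D differentiable at 0"
    unfolding D_def opt_den_def[abs_def] A5_def
    by (intro derivative_intros) (use assms in auto)
  have "gopt differentiable at 0" "Jmin differentiable at 0"
    unfolding gopt_def[abs_def] Jmin_def[abs_def]
    by (intro derivative_intros dN dD; use D0 in simp)+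
  then obtain C3 C4 where
    C3: "(\<lambda>n. \<bar>gopt 0 - gopt (mesh x0 n)\<bar> - C3 * mesh x0 n) \<in> o(\<lambda>n. mesh x0 n)" and
    C4: "(\<lambda>n. \<bar>Jmin 0 - Jmin (mesh x0 n)\<bar> - C4 * mesh x0 n) \<in> o(\<lambda>n. mesh x0 n)"
    using mesh_expansion_abs_diff[OF \<open>x0 > 0\<close>] by metis
  \<comment> \<open>For \<open>n = 0\<close> there is no grid; the formulas hold only eventually, which is enough.\<close>
  have ev: "\<forall>\<^sub>F n in sequentially. n \<ge> (1::nat)"
    by (rule eventually_ge_at_top)
  have "(\<lambda>n. \<bar>g_op x0 y0 \<alpha> q b zd M1 - g_op_disc x0 y0 \<alpha> q b zd M1 n\<bar> - C3 * mesh x0 n)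
      \<in> o(\<lambda>n. mesh x0 n)"
    by (rule landau_o.small.in_cong[THEN iffD2, OF _ C3])
      (use ev in eventually_elim, simp add: g0 gn)
  moreover have "(\<lambda>n. \<bar>J1 x0 y0 \<alpha> q b zd M1 (g_op x0 y0 \<alpha> q b zd M1)
        - J1_disc x0 y0 \<alpha> q b zd M1 n (g_op_disc x0 y0 \<alpha> q b zd M1 n)\<bar> - C4 * mesh x0 n)
      \<in> o(\<lambda>n. mesh x0 n)"
    by (rule landau_o.small.in_cong[THEN iffD2, OF _ C4])
      (use ev in eventually_elim, simp add: g0 gn J0 Jmn)
  ultimately show ?thesis
    using arg argn by (auto simp: Let_def gn formula)
qed

end
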